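(* Let $\mathcal{D},\mathcal{A},\mathcal{X},\mathcal{Y}$ be finite nonempty sets, let $C_{da}:\mathcal{X}\times\mathcal{Y}\to\mathbb{R}$ be a channel for each $(d,a)\in\mathcal{D}\times\mathcal{A}$, let $\pi\in\mathbb{D}\mathcal{X}$, and let $\mathbb{V}:\mathbb{D}\mathcal{X}\to\mathbb{R}$ be a vulnerability. Below, $\delta$ ranges over $\mathbb{D}\mathcal{D}$, $\alpha$ over $\mathbb{D}\mathcal{A}$, $\sigma_{\mathsf a}$ over $\mathbb{D}(\mathcal{D}\to\mathcal{A})$ and $\sigma_{\mathsf d}$ over $\mathbb{D}(\mathcal{A}\to\mathcal{D})$. Then: (a) $$\min_{\delta}\max_{\sigma_{\mathsf a}}\mathbb{V}\Big[\pi,\bigsqcup_{\substack{d\leftarrow\delta\\ s_{\mathsf a}\leftarrow\sigma_{\mathsf a}}}C_{d\,s_{\mathsf a}(d)}\Big]\ \ge\ \min_{\delta}\max_{\alpha}\mathbb{V}\Big[\pi,\bigsqcup_{\substack{d\leftarrow\delta\\ a\leftarrow\alpha}}C_{da}\Big]\ \ge\ \max_{\alpha}\min_{\sigma_{\mathsf d}}\mathbb{V}\Big[\pi,\bigsqcup_{\substack{s_{\mathsf d}\leftarrow\sigma_{\mathsf d}\\ a\leftarrow\alpha}}C_{s_{\mathsf d}(a)\,a}\Big];$$ (b) $$\min_{\delta}\max_{\alpha}\mathbb{V}\Big[\pi,\bigsqcup_{a\leftarrow\alpha}\ \bigoplus_{d\leftarrow\delta}C_{da}\Big]\ \ge\ \max_{\alpha}\min_{\sigma_{\mathsf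 d}}\mathbb{V}\Big[\pi,\bigsqcup_{a\leftarrow\alpha}\ \bigoplus_{s_{\mathsf d}\leftarrow\sigma_{\mathsf d}}C_{s_{\mathsf d}(a)\,a}\Big].$$
   Context: For a finite set $\mathcal{S}$, $\mathbb{D}\mathcal{S}$ is the set of probability distributions on $\mathcal{S}$. $\mathcal{D}\to\mathcal{A}$ denotes the (finite) set of all functions $s_{\mathsf a}:\mathcal{D}\to\mathcal{A}$, and $\mathcal{A}\to\mathcal{D}$ the set of all functions $s_{\mathsf d}:\mathcal{A}\to\mathcal{D}$. ($\mathcal{D}$, $\mathcal{A}$ are the actions of a defender who minimizes and an attacker who maximizes the payoff; distributions on functions are mixed strategies of a player who moves second, knowing the other's action.) A channel of type $\mathcal{X}\times\mathcal{Y}\to\mathbb{R}$ is a matrix $C:\mathcal{X}\times\mathcal{Y}\to\mathbb{R}$ with nonnegative entries and $\sum_{y\in\mathcal{Y}}C(x,y)=1$ for all $x\in\mathcal{X}$; $\mathcal{X}$ is its input set and $\mathcal{Y}$ its output set. Hidden choice (for channels $C_k$, $k\in\mathcal{K}$, with the same input and output sets and $\nu\in\mathbb{D}\mathcal{K}$, $\mathcal{K}$ finite): $\bigoplus_{k\leftarrow\nu}C_k=\sum_{k\in\mathcal{K}}\nu(k)C_k$. Visible choice (for channels $C_k:\mathcal{X}\times\mathcal{Y}_k\to\mathbb{R}$): $\bigsqcup_{k\leftarrow\nu}C_k$ is the channel with input set $\mathcal{X}$ and output set the disjoint union $\{(y,k)\mid k\in\mathcal{K},y\in\mathcal{Y}_k\}$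 given by $(x,(y,k))\mapsto\nu(k)C_k(x,y)$. A visible choice with two subscripts $k\leftarrow\nu$, $l\leftarrow\nu'$ is the visible choice over the index pairs $(k,l)$ with product distribution $\nu(k)\nu'(l)$. A vulnerability is any continuous convex function $\mathbb{V}:\mathbb{D}\mathcal{X}\to\mathbb{R}$. For a prior $\pi\in\mathbb{D}\mathcal{X}$ and a channel $C:\mathcal{X}\times\mathcal{Y}\to\mathbb{R}$, put $p(y)=\sum_{x}\pi(x)C(x,y)$ and, when $p(y)\ne0$, let $p_{X\mid y}\in\mathbb{D}\mathcal{X}$ be $x\mapsto\pi(x)C(x,y)/p(y)$. The posterior vulnerability is $\mathbb{V}[\pi,C]=\sum_{y\in\mathcal{Y},\,p(y)\neq0}p(y)\,\mathbb{V}(p_{X\mid y})$. *)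

theory Defs
  imports "HOL-Analysis.Analysis"
begin

text \<open>Finite nonempty sets are finite types, and real-valued functions on them are vectors, so that
  continuity and convexity on the simplex are the library notions. A matrix indexed by
  \<open>\<X> \<times> \<Y>\<close> has type \<open>real^'y^'x\<close>, with entry \<open>C $ x $ y\<close>.\<close>

definition dists :: "(real^'s) set" where
  "dists = {p. (\<forall>i. 0 \<le> p $ i) \<and> (\<Sum>i\<in>UNIV. p $ i) = 1}"

definition is_channel :: "real^'y^'x \<Rightarrow> bool" where
  "is_channel C \<longleftrightarrow> (\<forall>x y. 0 \<le> C $ x $ y) \<and> (\<forall>x. (\<Sum>y\<in>UNIV. C $ x $ y) = 1)"

definition hidden_choice :: "real^'k \<Rightarrow> ('k \<Rightarrow> real^'y^'x) \<Rightarrow> real^'y^'x" where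
  "hidden_choice \<nu> C = (\<Sum>k\<in>UNIV. \<nu> $ k *\<^sub>R C k)"

definition visible_choice :: "real^'k \<Rightarrow> ('k \<Rightarrow> real^'y^'x) \<Rightarrow> real^('y \<times> 'k)^'x" where
  "visible_choice \<nu> C = (\<chi> x. \<chi> yk. \<nu> $ snd yk * C (snd yk) $ x $ fst yk)"

definition product_dist :: "real^'k \<Rightarrow> real^'l \<Rightarrow> real^('k \<times> 'l)" where
  "product_dist \<nu> \<nu>' = (\<chi> kl. \<nu> $ fst kl * \<nu>' $ snd kl)"

text \<open>Only the values of \<open>V\<close> on \<open>dists\<close> matter.\<close>

definition vulnerability :: "(real^'x \<Rightarrow> real) \<Rightarrow> bool" where
  "vulnerability V \<longleftrightarrow> continuous_on dists V \<and> convex_on dists V"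

definition out_prob :: "real^'x \<Rightarrow> real^'y^'x \<Rightarrow> 'y \<Rightarrow> real" where
  "out_prob \<pi> C y = (\<Sum>x\<in>UNIV. \<pi> $ x * C $ x $ y)"

definition posterior :: "real^'x \<Rightarrow> real^'y^'x \<Rightarrow> 'y \<Rightarrow> real^'x" where
  "posterior \<pi> C y = (\<chi> x. \<pi> $ x * C $ x $ y / out_prob \<pi> C y)"

definition post_vuln :: "(real^'x \<Rightarrow> real) \<Rightarrow> real^'x \<Rightarrow> real^'y^'x \<Rightarrow> real" where
  "post_vuln V \<pi> C = (\<Sum>y | out_prob \<pi> C y \<noteq> 0. out_prob \<pi> C y * V (posterior \<pi> C y))"

text \<open>Minimum and maximum of a function over a possibly infinite set. These are attained values, not
  infima and suprema; the value is unspecified if \<open>has_min\<close> or \<open>has_max\<close> fails.\<close>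

definition has_min :: "'s set \<Rightarrow> ('s \<Rightarrow> real) \<Rightarrow> bool" where
  "has_min S f \<longleftrightarrow> (\<exists>x\<in>S. \<forall>y\<in>S. f x \<le> f y)"

definition has_max :: "'s set \<Rightarrow> ('s \<Rightarrow> real) \<Rightarrow> bool" where
  "has_max S f \<longleftrightarrow> (\<exists>x\<in>S. \<forall>y\<in>S. f y \<le> f x)"

definition min_over :: "'s set \<Rightarrow> ('s \<Rightarrow> real) \<Rightarrow> real" where
  "min_over S f = (LEAST v. v \<in> f ` S)"

definition max_over :: "'s set \<Rightarrow> ('s \<Rightarrow> real) \<Rightarrow> real" where
  "max_over S f = (GREATEST v. v \<in> f ` S)"

definition min_max :: "'s set \<Rightarrow> 't set \<Rightarrow> ('s \<Rightarrow> 't \<Rightarrow> real) \<Rightarrow> real" where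
  "min_max S T f = min_over S (\<lambda>s. max_over T (f s))"

definition max_min :: "'s set \<Rightarrow> 't set \<Rightarrow> ('s \<Rightarrow> 't \<Rightarrow> real) \<Rightarrow> real" where
  "max_min S T f = max_over S (\<lambda>s. min_over T (f s))"

definition has_min_max :: "'s set \<Rightarrow> 't set \<Rightarrow> ('s \<Rightarrow> 't \<Rightarrow> real) \<Rightarrow> bool" where
  "has_min_max S T f \<longleftrightarrow> (\<forall>s\<in>S. has_max T (f s)) \<and> has_min S (\<lambda>s. max_over T (f s))"

definition has_max_min :: "'s set \<Rightarrow> 't set \<Rightarrow> ('s \<Rightarrow> 't \<Rightarrow> real) \<Rightarrow> bool" where
  "has_max_min S T f \<longleftrightarrow> (\<forall>s\<in>S. has_min T (f s)) \<and> has_max S (\<lambda>s. min_over T (f s))"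

end

theory Submission
  imports Defs
begin

text \<open>A posterior vulnerability is a sum of values of the perspective of \<open>V\<close>. The perspective is
  positively homogeneous, so a visible choice acts linearly on posterior vulnerabilities, and it is
  continuous on the nonnegative orthant because \<open>V\<close> is bounded on the simplex; hence all payoffs are
  jointly continuous on compact sets and the optima are attained. A mixed action of a player pushes
  forward to a mixture of constant strategies with the same payoff, so knowing the other player's
  action can only help; with weak duality this gives all the inequalities.\<close>

section \<open>Attained minima and maxima\<close>

lemma min_over_le:
  assumes "has_min S f" "x \<in> S"
  shows "min_over S f \<le> f x"
proof -
  obtain z where z: "z \<in> S" "\<forall>y\<in>S. f z \<le> f y"
    using assms(1) unfolding has_min_def by blast
  have "min_over S f = f z"
    unfolding min_over_def by (rule Least_equality) (use z in auto)
  then show ?thesis using z assms(2) by simp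
qed

lemma min_over_attained:
  assumes "has_min S f"
  obtains x where "x \<in> S" "min_over S f = f x"
proof -
  obtain z where z: "z \<in> S" "\<forall>y\<in>S. f z \<le> f y"
    using assms(1) unfolding has_min_def by blast
  have "min_over S f = f z"
    unfolding min_over_def by (rule Least_equality) (use z in auto)
  then show ?thesis using z that by blast
qed

lemma max_over_ge:
  assumes "has_max S f" "x \<in> S"
  shows "f x \<le> max_over S f"
proof -
  obtain z where z: "z \<in> S" "\<forall>y\<in>S. f y \<le> f z"
    using assms(1) unfolding has_max_def by blast
  have "max_over S f = f z"
    unfolding max_over_def by (rule Greatest_equality) (use z in auto)
  then show ?thesis using z assms(2) by simp
qed

lemma max_over_attained:
  assumes "has_max S f"
  obtains x where "x \<in> S" "max_over S f = f x"
proof -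
  obtain z where z: "z \<in> S" "\<forall>y\<in>S. f y \<le> f z"
    using assms(1) unfolding has_max_def by blast
  have "max_over S f = f z"
    unfolding max_over_def by (rule Greatest_equality) (use z in auto)
  then show ?thesis using z that by blast
qed

lemma has_min_uminus_iff: "has_min S (\<lambda>x. - f x) \<longleftrightarrow> has_max S f"
  unfolding has_min_def has_max_def by simp

text \<open>A minimizer of \<open>f\<close> and a maximizer of \<open>- f\<close> are each a
  competitor for the other. With it, results about maxima carry over to minima.\<close>

lemma min_over_eq_uminus_max_over:
  assumes "has_min S f"
  shows "min_over S f = - max_over S (\<lambda>x. - f x)"
proof -
  have mx: "has_max S (\<lambda>x. - f x)"
    using assms has_min_uminus_iff[of S "\<lambda>x. - f x"] by simp
  obtain x where x: "x \<in> S" "min_over S f = f x"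
    using min_over_attained[OF assms] .
  obtain y where y: "y \<in> S" "max_over S (\<lambda>x. - f x) = - f y"
    using max_over_attained[OF mx] .
  show ?thesis
    using min_over_le[OF assms y(1)] max_over_ge[OF mx x(1)] x y by simp
qed

lemma has_max_continuous:
  assumes "compact S" "S \<noteq> {}" "continuous_on S f"
  shows "has_max S f"
  unfolding has_max_def using continuous_attains_sup[OF assms] .

lemma has_min_continuous:
  assumes "compact S" "S \<noteq> {}" "continuous_on S f"
  shows "has_min S f"
  unfolding has_min_def using continuous_attains_inf[OF assms] .

text \<open>Joint continuity on a compact product is uniform, so a single \<open>d\<close> serves
  all \<open>t\<close> at once, whatever maximizer is chosen.\<close>

lemma continuous_on_max_over:
  fixes f :: "'s::metric_space \<Rightarrow> 't::metric_space \<Rightarrow> real"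
  assumes S: "compact S" and T: "compact T"
    and mx: "\<And>s. s \<in> S \<Longrightarrow> has_max T (f s)"
    and cont: "continuous_on (S \<times> T) (\<lambda>(s, t). f s t)"
  shows "continuous_on S (\<lambda>s. max_over T (f s))"
  unfolding continuous_on_iff
proof (intro ballI allI impI)
  fix s and e :: real assume s: "s \<in> S" and e: "e > 0"
  have "uniformly_continuous_on (S \<times> T) (\<lambda>(s, t). f s t)"
    using compact_uniformly_continuous[OF cont compact_Times[OF S T]] .
  then obtain d where d: "d > 0"
    and close: "\<And>p q. \<lbrakk>p \<in> S \<times> T; q \<in> S \<times> T; dist q p < d\<rbrakk>
        \<Longrightarrow> dist (case q of (s, t) \<Rightarrow> f s t) (case p of (s, t) \<Rightarrow> f s t) < e"
    using e unfolding uniformly_continuous_on_def by metis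
  \<comment> \<open>A maximizer at \<open>u\<close> is a competitor at \<open>v\<close>, where its
    value drops by less than \<open>e\<close>. Exchanging \<open>u\<close> and \<open>v\<close>
    gives the two-sided estimate.\<close>
  have less: "max_over T (f u) < max_over T (f v) + e"
    if uv: "u \<in> S" "v \<in> S" "dist u v < d" for u v
  proof -
    obtain t where t: "t \<in> T" "max_over T (f u) = f u t"
      using max_over_attained[OF mx[OF uv(1)]] .
    have "dist (f u t) (f v t) < e"
      using close[of "(v, t)" "(u, t)"] uv t by (simp add: dist_Pair_Pair)
    moreover have "f v t \<le> max_over T (f v)"
      using max_over_ge[OF mx[OF uv(2)] t(1)] .
    ultimately show ?thesis using t by (simp add: dist_real_def)
  qed
  show "\<exists>d>0. \<forall>s'\<in>S. dist s' s < d \<longrightarrow> dist (max_over T (f s')) (max_over T (f s)) < e"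
  proof (intro exI conjI ballI impI)
    fix s' assume s': "s' \<in> S" "dist s' s < d"
    then show "dist (max_over T (f s')) (max_over T (f s)) < e"
      using less[of s' s] less[of s s'] s by (simp add: dist_real_def dist_commute abs_less_iff)
  qed (rule d)
qed

text \<open>Inner maxima exist because each section is continuous; the outer minimum exists because
  the value of the inner maximum is continuous in \<open>s\<close>.\<close>

lemma has_min_max_continuous:
  fixes f :: "'s::metric_space \<Rightarrow> 't::metric_space \<Rightarrow> real"
  assumes S: "compact S" "S \<noteq> {}" and T: "compact T" "T \<noteq> {}"
    and cont: "continuous_on (S \<times> T) (\<lambda>(s, t). f s t)"
  shows "has_min_max S T f"
proof -
  have "continuous_on T (f s)" if "s \<in> S" for s
  proof -
    have "continuous_on T (\<lambda>t. case (s, t) of (s, t) \<Rightarrow> f s t)"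
      by (rule continuous_on_compose2[OF cont]) (use that in \<open>auto intro!: continuous_intros\<close>)
    then show ?thesis by simp
  qed
  then have mx: "has_max T (f s)" if "s \<in> S" for s
    using that T has_max_continuous by blast
  show ?thesis
    unfolding has_min_max_def
    using mx has_min_continuous[OF S continuous_on_max_over[OF S(1) T(1) mx cont]] by blast
qed

text \<open>Negating the payoff exchanges minima and maxima and reduces this to
  \<open>has_min_max_continuous\<close>.\<close>

lemma has_max_min_continuous:
  fixes f :: "'s::metric_space \<Rightarrow> 't::metric_space \<Rightarrow> real"
  assumes S: "compact S" "S \<noteq> {}" and T: "compact T" "T \<noteq> {}"
    and cont: "continuous_on (S \<times> T) (\<lambda>(s, t). f s t)"
  shows "has_max_min S T f"
proof -
  have "continuous_on (S \<times> T) (\<lambda>(s, t). - f s t)"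
    using continuous_on_minus[OF cont] by (simp add: case_prod_beta)
  then have neg: "has_min_max S T (\<lambda>s t. - f s t)"
    by (rule has_min_max_continuous[OF S T])
  have mn: "has_min T (f s)" if "s \<in> S" for s
    using neg that has_min_uminus_iff[of T "\<lambda>t. - f s t"] by (simp add: has_min_max_def)
  have "has_max S (\<lambda>s. - max_over T (\<lambda>t. - f s t))"
    using neg has_min_uminus_iff[of S "\<lambda>s. - max_over T (\<lambda>t. - f s t)"]
    by (simp add: has_min_max_def)
  moreover have "min_over T (f s) = - max_over T (\<lambda>t. - f s t)" if "s \<in> S" for s
    using min_over_eq_uminus_max_over[OF mn[OF that]] .
  ultimately show ?thesis
    unfolding has_max_min_def has_max_def using mn by simp
qed

text \<open>The comparison is made at the \<open>s\<close> that is optimal for \<open>g\<close>. The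
  reply \<open>t'\<close> may depend on both \<open>s\<close> and \<open>t\<close>, and the two
  inner players may have different strategy sets.\<close>

lemma min_max_mono:
  assumes f: "has_min_max S T f" and g: "has_min_max S T' g"
    and le: "\<And>s t. \<lbrakk>s \<in> S; t \<in> T\<rbrakk> \<Longrightarrow> \<exists>t'\<in>T'. f s t \<le> g s t'"
  shows "min_max S T f \<le> min_max S T' g"
proof -
  obtain s where s: "s \<in> S" "min_max S T' g = max_over T' (g s)"
    using g min_over_attained unfolding has_min_max_def min_max_def by metis
  obtain t where t: "t \<in> T" "max_over T (f s) = f s t"
    using f s max_over_attained unfolding has_min_max_def by metis
  obtain t' where t': "t' \<in> T'" "f s t \<le> g s t'"
    using le s t by blast
  have "min_max S T f \<le> max_over T (f s)"
    using f s min_over_le[of S "\<lambda>s. max_over T (f s)"] unfolding has_min_max_def min_max_def by blast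
  also have "\<dots> \<le> g s t'" using t t' by simp
  also have "\<dots> \<le> max_over T' (g s)"
    using g s t' by (auto simp: has_min_max_def intro: max_over_ge)
  finally show ?thesis using s by simp
qed

text \<open>Weak duality between two games: take \<open>s\<close> optimal for the min-max of
  \<open>f\<close> and \<open>t\<close> optimal for the max-min of \<open>g\<close>, and pass
  through \<open>f s t\<close>. The minimizer of \<open>g\<close> moves second and may use an
  \<open>s'\<close> that depends on both.\<close>

lemma max_min_le_min_max:
  assumes f: "has_min_max S T f" and g: "has_max_min T S' g"
    and le: "\<And>s t. \<lbrakk>s \<in> S; t \<in> T\<rbrakk> \<Longrightarrow> \<exists>s'\<in>S'. g t s' \<le> f s t"
  shows "max_min T S' g \<le> min_max S T f"
proof -
  obtain s where s: "s \<in> S" "min_max S T f = max_over T (f s)"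
    using f min_over_attained unfolding has_min_max_def min_max_def by metis
  obtain t where t: "t \<in> T" "max_min T S' g = min_over S' (g t)"
    using g max_over_attained unfolding has_max_min_def max_min_def by metis
  obtain s' where s': "s' \<in> S'" "g t s' \<le> f s t"
    using le s t by blast
  have "min_over S' (g t) \<le> g t s'"
    using g s' t by (auto simp: has_max_min_def intro: min_over_le)
  also have "\<dots> \<le> f s t" by (fact s')
  also have "\<dots> \<le> max_over T (f s)"
    using f s t by (auto simp: has_min_max_def intro: max_over_ge)
  finally show ?thesis using s t by simp
qed

section \<open>Distributions\<close>

lemma dists_nonempty: "dists \<noteq> ({} :: (real^'s::finite) set)"
proof -
  have "axis undefined 1 \<in> (dists :: (real^'s) set)"
    unfolding dists_def by (auto simp: axis_def)
  then show ?thesis by blast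
qed

lemma compact_dists: "compact (dists :: (real^'s::finite) set)"
proof -
  have "norm p \<le> 1" if "p \<in> dists" for p :: "real^'s"
    using norm_le_l1_cart[of p] that by (simp add: dists_def)
  then have "bounded (dists :: (real^'s) set)"
    unfolding bounded_iff by blast
  moreover have "closed (dists :: (real^'s) set)"
    unfolding dists_def
    by (intro closed_Collect_conj closed_Collect_all closed_Collect_le closed_Collect_eq continuous_intros)
  ultimately show ?thesis by (simp add: compact_eq_bounded_closed)
qed

text \<open>The image measure of \<nu> under \<open>h\<close>.\<close>

definition push_dist :: "('k::finite \<Rightarrow> 'l::finite) \<Rightarrow> real^'k \<Rightarrow> real^'l" where
  "push_dist h \<nu> = (\<chi> l. \<Sum>k | h k = l. \<nu> $ k)"

text \<open>Change of variables, by grouping the indices \<open>k\<close> into the fibres of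
  \<open>h\<close>. Vector values of \<open>g\<close> allow it to be applied to sums of channels as
  well as to sums of payoffs.\<close>

lemma sum_push_dist:
  fixes g :: "'l::finite \<Rightarrow> 'b::real_vector"
  shows "(\<Sum>l\<in>UNIV. push_dist h \<nu> $ l *\<^sub>R g l) = (\<Sum>k\<in>UNIV. \<nu> $ k *\<^sub>R g (h k))"
proof -
  have "(\<Sum>k\<in>UNIV. \<nu> $ k *\<^sub>R g (h k)) = (\<Sum>l\<in>UNIV. \<Sum>k | k \<in> UNIV \<and> h k = l. \<nu> $ k *\<^sub>R g (h k))"
    by (rule sum.group[symmetric]) auto
  also have "\<dots> = (\<Sum>l\<in>UNIV. push_dist h \<nu> $ l *\<^sub>R g l)"
    by (simp add: push_dist_def scaleR_sum_left)
  finally show ?thesis ..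
qed

lemma push_dist_in_dists:
  assumes "\<nu> \<in> dists"
  shows "push_dist h \<nu> \<in> dists"
  using assms sum_push_dist[of h \<nu> "\<lambda>_. 1 :: real"]
  by (simp add: dists_def) (simp add: push_dist_def sum_nonneg)

section \<open>Perspective functions\<close>

text \<open>The default 0 at mass 0 matches the omission of outputs of probability 0 in
  \<open>post_vuln\<close>; within the nonnegative orthant it concerns only the origin.\<close>

definition persp :: "(real^'x::finite \<Rightarrow> real) \<Rightarrow> real^'x \<Rightarrow> real" where
  "persp V q = (let s = \<Sum>x\<in>UNIV. q $ x in if s = 0 then 0 else s * V (q /\<^sub>R s))"

text \<open>A nonzero factor cancels in the normalized vector and survives only in the mass. For
  \<open>c = 0\<close> the default value makes both sides 0.\<close>

lemma persp_scaleR: "persp V (c *\<^sub>R q) = c * persp V q"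
proof (cases "c = 0")
  case False
  have sum: "(\<Sum>x\<in>UNIV. (c *\<^sub>R q) $ x) = c * (\<Sum>x\<in>UNIV. q $ x)"
    by (simp add: sum_distrib_left)
  have quot: "(c *\<^sub>R q) /\<^sub>R (c * s) = q /\<^sub>R s" for s
    using False by simp
  show ?thesis
    unfolding persp_def Let_def sum quot using False by simp
qed (simp add: persp_def)

lemma continuous_on_persp:
  fixes V :: "real^'x::finite \<Rightarrow> real"
  assumes V: "continuous_on dists V"
  shows "continuous_on {q. \<forall>x. 0 \<le> q $ x} (persp V)"
  unfolding continuous_on_def
proof
  let ?Q = "{q :: real^'x. \<forall>x. 0 \<le> q $ x}"
  define s :: "real^'x \<Rightarrow> real" where "s = (\<lambda>q. \<Sum>x\<in>UNIV. q $ x)"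
  have s_cont: "continuous_on A s" for A
    unfolding s_def by (intro continuous_intros)
  have s_nonneg: "s q \<ge> 0" if "q \<in> ?Q" for q
    using that by (simp add: s_def sum_nonneg)
  have norm_dist: "q /\<^sub>R s q \<in> dists" if "q \<in> ?Q" "s q \<noteq> 0" for q
    using that s_nonneg[OF that(1)]
    by (simp add: dists_def s_def flip: sum_distrib_left)
  fix q assume q: "q \<in> ?Q"
  show "(persp V \<longlongrightarrow> persp V q) (at q within ?Q)"
  proof (cases "s q = 0")
    case True
    have "bounded (V ` dists)"
      using compact_continuous_image[OF V compact_dists] by (rule compact_imp_bounded)
    then obtain B where B: "\<And>p. p \<in> dists \<Longrightarrow> \<bar>V p\<bar> \<le> B"
      unfolding bounded_iff by auto
    \<comment> \<open>The estimate holds at every point of the orthant, so the neighbourhood can be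
      \<open>UNIV\<close>. It squeezes \<open>persp V\<close> to 0 as the mass tends to 0, although
      the normalized vectors need not converge.\<close>
    have "\<forall>\<^sub>F r in at q within ?Q. norm (persp V r) \<le> s r * B"
    proof (rule eventually_at_topological[THEN iffD2, OF exI[of _ UNIV]], intro conjI ballI impI)
      fix r assume r: "r \<in> ?Q"
      show "norm (persp V r) \<le> s r * B"
        using B[OF norm_dist[OF r]] s_nonneg[OF r]
        by (auto simp: persp_def Let_def abs_mult mult_left_mono simp flip: s_def fun_cong[OF s_def])
    qed auto
    moreover have "((\<lambda>r. s r * B) \<longlongrightarrow> 0) (at q within ?Q)"
      using s_cont[of ?Q] q True tendsto_mult_left_zero
      unfolding continuous_on_def by metis
    ultimately have "(persp V \<longlongrightarrow> 0) (at q within ?Q)"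
      by (rule Lim_null_comparison)
    then show ?thesis using True by (simp add: persp_def s_def)
  next
    case False
    let ?R = "{r \<in> ?Q. s r \<noteq> 0}"
    have "continuous_on ?R (\<lambda>r. s r * V (r /\<^sub>R s r))"
    proof (intro continuous_on_mult s_cont continuous_on_compose2[OF V])
      show "continuous_on ?R (\<lambda>r. r /\<^sub>R s r)"
        by (intro continuous_intros s_cont) auto
    qed (use norm_dist in auto)
    moreover have "persp V r = s r * V (r /\<^sub>R s r)" if "r \<in> ?R" for r
      using that by (simp add: persp_def s_def)
    ultimately have "continuous_on ?R (persp V)"
      using continuous_on_cong by (metis (no_types, lifting))
    then have "(persp V \<longlongrightarrow> persp V q) (at q within ?R)"
      using q False unfolding continuous_on_def by blast
    \<comment> \<open>Nonzero mass is an open condition that holds at \<open>q\<close>, so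
      restricting to it does not change the limit there.\<close>
    moreover have "at q within ?R = at q within ?Q"
    proof (rule at_within_nhd)
      show "open (s -` (- {0}))"
        using s_cont[of UNIV] by (intro open_vimage) auto
    qed (use False in auto)
    ultimately show ?thesis by simp
  qed
qed

text \<open>The column of the joint distribution at \<open>y\<close> has mass
  \<open>out_prob\<close> and normalizes to \<open>posterior\<close>. The sum now runs over all
  outputs, with no condition that varies with the channel.\<close>

lemma post_vuln_eq_sum_persp:
  "post_vuln V \<pi> C = (\<Sum>y\<in>UNIV. persp V (\<chi> x. \<pi> $ x * C $ x $ y))"
proof -
  have "persp V (\<chi> x. \<pi> $ x * C $ x $ y)
      = (if out_prob \<pi> C y \<noteq> 0 then out_prob \<pi> C y * V (posterior \<pi> C y) else 0)" for y
  proof -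
    have "(\<chi> x. \<pi> $ x * C $ x $ y) /\<^sub>R out_prob \<pi> C y = posterior \<pi> C y"
      by (simp add: posterior_def vec_eq_iff divide_inverse mult.commute)
    then show ?thesis by (simp add: persp_def out_prob_def)
  qed
  then show ?thesis by (simp add: post_vuln_def sum.If_cases)
qed

text \<open>The joint column at \<open>(y, k)\<close> is that of \<open>C k\<close> at
  \<open>y\<close> scaled by \<open>\<nu> $ k\<close>, and homogeneity of \<open>persp\<close> pulls
  the factor out.\<close>

lemma post_vuln_visible_choice:
  "post_vuln V \<pi> (visible_choice \<nu> C) = (\<Sum>k\<in>UNIV. \<nu> $ k * post_vuln V \<pi> (C k))"
proof -
  have "(\<chi> x. \<pi> $ x * visible_choice \<nu> C $ x $ (y, k)) = \<nu> $ k *\<^sub>R (\<chi> x. \<pi> $ x * C k $ x $ y)"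
    for y k
    by (simp add: visible_choice_def vec_eq_iff)
  then have "post_vuln V \<pi> (visible_choice \<nu> C)
      = (\<Sum>(y, k)\<in>UNIV \<times> UNIV. \<nu> $ k * persp V (\<chi> x. \<pi> $ x * C k $ x $ y))"
    unfolding post_vuln_eq_sum_persp UNIV_Times_UNIV
    by (intro sum.cong) (auto simp: persp_scaleR)
  also have "\<dots> = (\<Sum>k\<in>UNIV. \<nu> $ k * post_vuln V \<pi> (C k))"
    unfolding sum.cartesian_product[symmetric]
    by (subst sum.swap) (simp add: post_vuln_eq_sum_persp sum_distrib_left)
  finally show ?thesis .
qed

lemma post_vuln_visible_choice_product:
  "post_vuln V \<pi> (visible_choice (product_dist \<nu> \<nu>') (\<lambda>(k, l). C k l))
    = (\<Sum>k\<in>UNIV. \<Sum>l\<in>UNIV. \<nu> $ k * \<nu>' $ l * post_vuln V \<pi> (C k l))"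
  unfolding post_vuln_visible_choice sum.cartesian_product UNIV_Times_UNIV
  by (simp add: product_dist_def case_prod_beta)

text \<open>Each joint column depends linearly on the channel and stays in the nonnegative orthant,
  where \<open>persp V\<close> is continuous.\<close>

lemma continuous_on_post_vuln:
  assumes V: "continuous_on dists V" and \<pi>: "\<pi> \<in> dists"
  shows "continuous_on {C. is_channel C} (post_vuln V \<pi>)"
  unfolding post_vuln_eq_sum_persp
proof (intro continuous_on_sum continuous_on_compose2[OF continuous_on_persp[OF V]])
  fix y
  show "continuous_on {C. is_channel C} (\<lambda>C. \<chi> x. \<pi> $ x * C $ x $ y)"
    by (intro continuous_intros)
  show "(\<lambda>C. \<chi> x. \<pi> $ x * C $ x $ y) ` {C. is_channel C} \<subseteq> {q. \<forall>x. 0 \<le> q $ x}"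
    using \<pi> by (auto simp: is_channel_def dists_def)
qed

lemma is_channel_hidden_choice:
  assumes "\<nu> \<in> dists" "\<And>k. is_channel (C k)"
  shows "is_channel (hidden_choice \<nu> C)"
proof -
  have "(\<Sum>y\<in>UNIV. \<Sum>k\<in>UNIV. \<nu> $ k * C k $ x $ y) = 1" for x
    using assms by (subst sum.swap) (simp add: is_channel_def dists_def flip: sum_distrib_left)
  then show ?thesis
    using assms by (auto simp: is_channel_def hidden_choice_def dists_def intro!: sum_nonneg)
qed

text \<open>The payoff is linear in \<nu>', but \<nu> enters inside the posterior vulnerability.
  Hidden choices of channels are channels, so \<open>continuous_on_post_vuln\<close> applies to
  them.\<close>

lemma continuous_on_visible_hidden:
  assumes V: "continuous_on dists V" and \<pi>: "\<pi> \<in> dists" and C: "\<And>k l. is_channel (C k l)"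
  shows "continuous_on (dists \<times> dists)
    (\<lambda>(\<nu>, \<nu>'). post_vuln V \<pi> (visible_choice \<nu>' (\<lambda>l. hidden_choice \<nu> (\<lambda>k. C k l))))"
  unfolding post_vuln_visible_choice case_prod_beta
proof (intro continuous_on_sum continuous_on_mult
    continuous_on_compose2[OF continuous_on_post_vuln[OF V \<pi>]])
  fix l
  show "continuous_on (dists \<times> dists) (\<lambda>p. hidden_choice (fst p) (\<lambda>k. C k l))"
    unfolding hidden_choice_def by (intro continuous_intros)
  show "(\<lambda>p. hidden_choice (fst p) (\<lambda>k. C k l)) ` (dists \<times> dists) \<subseteq> {C. is_channel C}"
    using C by (auto intro: is_channel_hidden_choice)
qed (intro continuous_intros)

text \<open>By the product formula the payoff is a bilinear polynomial in the entries of the two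
  distributions.\<close>

lemma continuous_on_visible_product:
  "continuous_on S (\<lambda>(\<nu>, \<nu>'). post_vuln V \<pi> (visible_choice (product_dist \<nu> \<nu>') (\<lambda>(k, l). C k l)))"
  unfolding post_vuln_visible_choice_product case_prod_beta
  by (intro continuous_intros)

section \<open>The games\<close>

text \<open>Attainment is part of the conclusion because \<open>min_max\<close> and
  \<open>max_min\<close> rest on \<open>LEAST\<close> and \<open>GREATEST\<close>, which are
  informative only when the optimum exists.\<close>

theorem theorem16:
  fixes C :: "'d::finite \<Rightarrow> 'a::finite \<Rightarrow> real^'y::finite^'x::finite"
    and \<pi> :: "real^'x"
    and V :: "real^'x \<Rightarrow> real"
  assumes "\<And>d a. is_channel (C d a)"
    and "\<pi> \<in> dists"
    and "vulnerability V"
  shows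
    "let vis_a = (\<lambda>(\<delta> :: real^'d) (\<sigma>a :: real^('d \<Rightarrow> 'a)).
           post_vuln V \<pi> (visible_choice (product_dist \<delta> \<sigma>a) (\<lambda>(d, sa). C d (sa d))));
         vis = (\<lambda>(\<delta> :: real^'d) (\<alpha> :: real^'a).
           post_vuln V \<pi> (visible_choice (product_dist \<delta> \<alpha>) (\<lambda>(d, a). C d a)));
         vis_d = (\<lambda>(\<alpha> :: real^'a) (\<sigma>d :: real^('a \<Rightarrow> 'd)).
           post_vuln V \<pi> (visible_choice (product_dist \<sigma>d \<alpha>) (\<lambda>(sd, a). C (sd a) a)));
         hid = (\<lambda>(\<delta> :: real^'d) (\<alpha> :: real^'a).
           post_vuln V \<pi> (visible_choice \<alpha> (\<lambda>a. hidden_choice \<delta> (\<lambda>d. C d a))));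
         hid_d = (\<lambda>(\<alpha> :: real^'a) (\<sigma>d :: real^('a \<Rightarrow> 'd)).
           post_vuln V \<pi> (visible_choice \<alpha> (\<lambda>a. hidden_choice \<sigma>d (\<lambda>sd. C (sd a) a))))
     in (has_min_max dists dists vis_a \<and> has_min_max dists dists vis \<and> has_max_min dists dists vis_d
           \<and> min_max dists dists vis_a \<ge> min_max dists dists vis
           \<and> min_max dists dists vis \<ge> max_min dists dists vis_d)
      \<and> (has_min_max dists dists hid \<and> has_max_min dists dists hid_d
           \<and> min_max dists dists hid \<ge> max_min dists dists hid_d)"
proof -
  note C = assms(1) and \<pi> = assms(2)
  have V: "continuous_on dists V"
    using assms(3) by (simp add: vulnerability_def)
  define vis_a where "vis_a = (\<lambda>(\<delta> :: real^'d) (\<sigma>a :: real^('d \<Rightarrow> 'a)).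
     post_vuln V \<pi> (visible_choice (product_dist \<delta> \<sigma>a) (\<lambda>(d, sa). C d (sa d))))"
  define vis where "vis = (\<lambda>(\<delta> :: real^'d) (\<alpha> :: real^'a).
     post_vuln V \<pi> (visible_choice (product_dist \<delta> \<alpha>) (\<lambda>(d, a). C d a)))"
  define vis_d where "vis_d = (\<lambda>(\<alpha> :: real^'a) (\<sigma>d :: real^('a \<Rightarrow> 'd)).
     post_vuln V \<pi> (visible_choice (product_dist \<sigma>d \<alpha>) (\<lambda>(sd, a). C (sd a) a)))"
  define hid where "hid = (\<lambda>(\<delta> :: real^'d) (\<alpha> :: real^'a).
     post_vuln V \<pi> (visible_choice \<alpha> (\<lambda>a. hidden_choice \<delta> (\<lambda>d. C d a))))"
  define hid_d where "hid_d = (\<lambda>(\<alpha> :: real^'a) (\<sigma>d :: real^('a \<Rightarrow> 'd)).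
     post_vuln V \<pi> (visible_choice \<alpha> (\<lambda>a. hidden_choice \<sigma>d (\<lambda>sd. C (sd a) a))))"
  note compact_nonempty = compact_dists dists_nonempty compact_dists dists_nonempty

  have vis_a: "has_min_max dists dists vis_a"
    unfolding vis_a_def
    by (rule has_min_max_continuous[OF compact_nonempty continuous_on_visible_product])
  have vis: "has_min_max dists dists vis"
    unfolding vis_def
    by (rule has_min_max_continuous[OF compact_nonempty continuous_on_visible_product])
  have vis_d: "has_max_min dists dists vis_d"
  proof (rule has_max_min_continuous[OF compact_nonempty])
    show "continuous_on (dists \<times> dists) (\<lambda>(\<alpha>, \<sigma>d). vis_d \<alpha> \<sigma>d)"
      \<comment> \<open>The outer player of \<open>vis_d\<close> chooses \<alpha>, whereas the
        product distribution lists the strategies of the defender first.\<close>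
      using continuous_on_swap_args[OF continuous_on_visible_product[of _ V \<pi> "\<lambda>sd a. C (sd a) a"]]
      unfolding vis_d_def .
  qed
  have hid: "has_min_max dists dists hid"
    unfolding hid_def
    by (rule has_min_max_continuous[OF compact_nonempty continuous_on_visible_hidden[OF V \<pi> C]])
  have hid_d: "has_max_min dists dists hid_d"
  proof (rule has_max_min_continuous[OF compact_nonempty])
    show "continuous_on (dists \<times> dists) (\<lambda>(\<alpha>, \<sigma>d). hid_d \<alpha> \<sigma>d)"
      using continuous_on_swap_args[OF continuous_on_visible_hidden[OF V \<pi>, of "\<lambda>sd a. C (sd a) a"]] C
      unfolding hid_d_def by blast
  qed

  \<comment> \<open>The map sends an action \<open>a\<close> to the strategy that plays
    \<open>a\<close> against every \<open>d\<close>, so the pushed distribution ignores the observed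
    action.\<close>
  have push_a: "vis_a \<delta> (push_dist (\<lambda>a _. a) \<alpha>) = vis \<delta> \<alpha>" for \<delta> \<alpha>
    unfolding vis_a_def vis_def post_vuln_visible_choice_product mult.assoc
      sum_distrib_left[symmetric]
    using sum_push_dist[of "\<lambda>a _. a" \<alpha> "\<lambda>sa. post_vuln V \<pi> (C d (sa d))" for d] by simp
  have push_d: "vis_d \<alpha> (push_dist (\<lambda>d _. d) \<delta>) = vis \<delta> \<alpha>" for \<delta> \<alpha>
    unfolding vis_d_def vis_def post_vuln_visible_choice_product mult.assoc
      sum_distrib_left[symmetric]
    using sum_push_dist[of "\<lambda>d _. d" \<delta> "\<lambda>sd. \<Sum>a\<in>UNIV. \<alpha> $ a * post_vuln V \<pi> (C (sd a) a)"] by simp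
  \<comment> \<open>Here the two hidden choices already agree as channels for each \<open>a\<close>,
    before \<open>V\<close> is applied.\<close>
  have push_hid: "hid_d \<alpha> (push_dist (\<lambda>d _. d) \<delta>) = hid \<delta> \<alpha>" for \<delta> \<alpha>
    unfolding hid_d_def hid_def hidden_choice_def sum_push_dist ..

  have "min_max dists dists vis \<le> min_max dists dists vis_a"
    by (rule min_max_mono[OF vis vis_a]) (metis push_a push_dist_in_dists order_refl)
  moreover have "max_min dists dists vis_d \<le> min_max dists dists vis"
    by (rule max_min_le_min_max[OF vis vis_d]) (metis push_d push_dist_in_dists order_refl)
  moreover have "max_min dists dists hid_d \<le> min_max dists dists hid"
    by (rule max_min_le_min_max[OF hid hid_d]) (metis push_hid push_dist_in_dists order_refl)
  ultimately show ?thesis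
    using vis_a vis vis_d hid hid_d
    unfolding Let_def vis_a_def vis_def vis_d_def hid_def hid_d_def by blast
qed

end
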